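(* Let $\alpha_1,\ldots,\alpha_n$ be positive integers and $\alpha=\alpha_1+\cdots+\alpha_n$. Then the constant term of the Laurent polynomial $$\prod_{1\leq i\neq j\leq n}\left(1-X_i/X_j\right)^{\alpha_i}$$ is equal to $\dfrac{\alpha!}{\alpha_1!\cdots\alpha_n!}$. Moreover, the coefficient of the monomial $\prod_{i=1}^nX_i^{\alpha-\alpha_i}$ in the polynomial $$f(X_1,\ldots,X_n)=\prod_{1\leq i<j\leq n}(-1)^{\alpha_j}(X_j-X_i)^{\alpha_i+\alpha_j}$$ is equal to $\dfrac{\alpha!}{\alpha_1!\cdots\alpha_n!}$.
   Context: The first product runs over all ordered pairs $(i,j)$ with $i\neq j$ and $1\le i,j\le n$. Polynomials are taken with rational (or integer) coefficients. *)

theory Defs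
  imports Complex_Main "HOL-Library.Poly_Mapping"
begin

(* A polynomial is a finitely supported map from exponent vectors to coefficients; the
   ring product of the library is the convolution product.  Laurent polynomials are
   obtained by letting the exponents range over the integers.  The variables X 0, X 1, ...
   are indexed by all natural numbers; any given polynomial involves finitely many of them. *)

type_synonym polynomial = "(nat \<Rightarrow>\<^sub>0 nat) \<Rightarrow>\<^sub>0 rat"
type_synonym laurent_polynomial = "(nat \<Rightarrow>\<^sub>0 int) \<Rightarrow>\<^sub>0 rat"

definition X :: "nat \<Rightarrow> polynomial" where
  "X i = Poly_Mapping.single (Poly_Mapping.single i 1) 1"

definition LX :: "nat \<Rightarrow> laurent_polynomial" where
  "LX i = Poly_Mapping.single (Poly_Mapping.single i 1) 1"

definition LX_inv :: "nat \<Rightarrow> laurent_polynomial" where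
  "LX_inv i = Poly_Mapping.single (Poly_Mapping.single i (-1)) 1"

lemma LX_mult_LX_inv: "LX i * LX_inv i = 1"
  by (simp add: LX_def LX_inv_def mult_single flip: single_add)

definition constant_term :: "laurent_polynomial \<Rightarrow> rat" where
  "constant_term p = Poly_Mapping.lookup p 0"

(* coefficient of the monomial (\<Prod>i\<in>I. X i ^ e i) for a finite set I of variable indices *)
definition coeff_monom :: "polynomial \<Rightarrow> nat set \<Rightarrow> (nat \<Rightarrow> nat) \<Rightarrow> rat" where
  "coeff_monom p I e = Poly_Mapping.lookup p (\<Sum>i\<in>I. Poly_Mapping.single i (e i))"

lemma X_power: "X i ^ k = Poly_Mapping.single (Poly_Mapping.single i k) 1"
  by (induction k) (simp_all add: X_def mult_single flip: single_add)

lemma prod_X_power: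
  "finite I \<Longrightarrow> (\<Prod>i\<in>I. X i ^ e i) = Poly_Mapping.single (\<Sum>i\<in>I. Poly_Mapping.single i (e i)) 1"
  by (induction I rule: finite_induct) (simp_all add: X_power mult_single)

end

theory Submission
  imports Defs "HOL-Computational_Algebra.Polynomial"
begin

text \<open>
  The first claim follows Good's proof of the Dyson conjecture.  Let \<open>D(I, a)\<close> be the product over
  the index set \<open>I\<close>.  Lagrange interpolation of the constant polynomial 1 at the variables,
  evaluated at 0, gives \<open>D(I, a) = \<Sum>i\<in>I. D(I, a - e\<^sub>i)\<close> if all exponents are
  positive.  If \<open>a k = 0\<close>, then \<open>X k\<close> occurs in \<open>D(I, a)\<close> only with nonpositive exponents, and
  discarding the terms in which it occurs leaves \<open>D(I - {k}, a)\<close>.  The multinomial coefficients satisfy the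
  same recursion.  For the second claim, \<open>1 - X\<^sub>i / X\<^sub>j = (X\<^sub>j - X\<^sub>i) / X\<^sub>j\<close> turns the
  Laurent polynomial into \<open>f\<close> divided by the monomial in question.
\<close>

section \<open>Good's recursion\<close>

text \<open>The family \<open>y\<close> stands for the inverses of \<open>x\<close>; naming it
  separately lets the algebra run in a ring without division. A row gathers all factors that carry
  the same exponent \<open>a i\<close>.\<close>

definition dyson_row :: "('i \<Rightarrow> 'a) \<Rightarrow> ('i \<Rightarrow> 'a) \<Rightarrow> 'i set \<Rightarrow> 'i \<Rightarrow> 'a::comm_ring_1" where
  "dyson_row x y I i = (\<Prod>j\<in>I - {i}. 1 - x i * y j)"

definition dyson_product ::
    "('i \<Rightarrow> 'a) \<Rightarrow> ('i \<Rightarrow> 'a) \<Rightarrow> 'i set \<Rightarrow> ('i \<Rightarrow> nat) \<Rightarrow> 'a::comm_ring_1" where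
  "dyson_product x y I a = (\<Prod>i\<in>I. dyson_row x y I i ^ a i)"

lemma degree_prod_linear_le:
  fixes f :: "'i \<Rightarrow> 'a::idom"
  assumes "finite A"
  shows "degree (\<Prod>j\<in>A. [:1, f j:]) \<le> card A"
proof -
  have "degree (\<Prod>j\<in>A. [:1, f j:]) \<le> (\<Sum>j\<in>A. degree [:1, f j:])"
    using degree_prod_sum_le[OF assms, of "\<lambda>j. [:1, f j:]"] by (simp add: o_def)
  also have "\<dots> \<le> (\<Sum>j\<in>A. 1)"
    by (intro sum_mono) simp
  finally show ?thesis by simp
qed

text \<open>This is the interpolation identity with denominators cleared: the Lagrange basis
  polynomial of the node \<open>x i\<close> is the product of
  \<open>(1 - z * y j) / (1 - x i * y j)\<close> over \<open>j \<noteq> i\<close>, and its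
  denominator is the row of \<open>i\<close>.\<close>

lemma sum_prod_dyson_row:
  fixes x y :: "'i \<Rightarrow> 'a::idom"
  assumes fin: "finite I" and ne: "I \<noteq> {}" and inj: "inj_on x I"
    and inv: "\<And>i. i \<in> I \<Longrightarrow> x i * y i = 1"
  shows "(\<Sum>i\<in>I. \<Prod>k\<in>I - {i}. dyson_row x y I k) = (\<Prod>k\<in>I. dyson_row x y I k)"
proof -
  let ?u = "dyson_row x y I"
  \<comment> \<open>\<open>p\<close> is the sum of the Lagrange basis polynomials multiplied by the
    product of all rows; \<open>q\<close> is the interpolated constant 1 multiplied by the same
    product.\<close>
  define p where "p = (\<Sum>i\<in>I. smult (\<Prod>k\<in>I - {i}. ?u k) (\<Prod>j\<in>I - {i}. [:1, - y j:]))"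
  define q where "q = [:\<Prod>k\<in>I. ?u k:]"
  have card_pos: "card I > 0"
    using fin ne by (simp add: card_gt_0_iff)
  have "degree p \<le> card I - 1"
    unfolding p_def
  proof (intro degree_sum_le fin)
    fix i assume "i \<in> I"
    then show "degree (smult (\<Prod>k\<in>I - {i}. ?u k) (\<Prod>j\<in>I - {i}. [:1, - y j:])) \<le> card I - 1"
      using degree_prod_linear_le[of "I - {i}" "\<lambda>j. - y j"] fin
      by (auto intro: order_trans[OF degree_smult_le])
  qed
  \<comment> \<open>By injectivity of \<open>x\<close> there are \<open>card I\<close> distinct
    nodes, so degrees below \<open>card I\<close> make agreement at the nodes suffice for
    equality.\<close>
  then have deg: "degree p < card (x ` I)" "degree q < card (x ` I)"
    using card_pos inj by (auto simp: card_image q_def)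
  have "p = q"
  proof (rule poly_eqI_degree[OF _ deg])
    fix z assume "z \<in> x ` I"
    then obtain m where m: "m \<in> I" and z: "z = x m" by blast
    have "poly p z = (\<Sum>i\<in>I. (\<Prod>k\<in>I - {i}. ?u k) * (\<Prod>j\<in>I - {i}. 1 - x m * y j))"
      by (simp add: p_def z poly_sum poly_prod)
    also have "\<dots> = (\<Sum>i\<in>I. if i = m then (\<Prod>k\<in>I. ?u k) else 0)"
    proof (intro sum.cong refl)
      fix i assume i: "i \<in> I"
      show "(\<Prod>k\<in>I - {i}. ?u k) * (\<Prod>j\<in>I - {i}. 1 - x m * y j)
          = (if i = m then (\<Prod>k\<in>I. ?u k) else 0)"
      proof (cases "i = m")
        case True
        then show ?thesis
          using prod.remove[OF fin m, of ?u] by (simp add: dyson_row_def mult.commute)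
      next
        case False
        \<comment> \<open>The factor with \<open>j = m\<close> is
          \<open>1 - x m * y m = 0\<close>.\<close>
        then have "(\<Prod>j\<in>I - {i}. 1 - x m * y j) = 0"
          using fin m inv[OF m] by (intro prod_zero bexI[of _ m]) auto
        then show ?thesis using False by simp
      qed
    qed
    also have "\<dots> = poly q z"
      using fin m by (simp add: q_def)
    finally show "poly p z = poly q z" .
  qed
  \<comment> \<open>At 0 every linear factor \<open>[:1, - y j:]\<close> takes the value 1, so only
    the row products remain.\<close>
  then have "poly p 0 = poly q 0" by simp
  then show ?thesis
    by (simp add: p_def q_def poly_sum poly_prod)
qed

text \<open>Positivity allows one copy of each row to be split off. Expanding the product of these
  copies by the interpolation identity gives summands in which exactly one row has lost a
  copy.\<close>

lemma dyson_product_recursion: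
  fixes x y :: "'i \<Rightarrow> 'a::idom"
  assumes fin: "finite I" and "I \<noteq> {}" "inj_on x I" "\<And>i. i \<in> I \<Longrightarrow> x i * y i = 1"
    and pos: "\<And>i. i \<in> I \<Longrightarrow> a i > 0"
  shows "dyson_product x y I a = (\<Sum>i\<in>I. dyson_product x y I (a(i := a i - 1)))"
proof -
  let ?u = "dyson_row x y I"
  have "dyson_product x y I a = (\<Prod>i\<in>I. ?u i) * (\<Prod>i\<in>I. ?u i ^ (a i - 1))"
    unfolding dyson_product_def prod.distrib[symmetric]
    using pos by (intro prod.cong refl) (simp flip: power_Suc)
  also have "\<dots> = (\<Sum>i\<in>I. (\<Prod>k\<in>I - {i}. ?u k) * (\<Prod>k\<in>I. ?u k ^ (a k - 1)))"
    using sum_prod_dyson_row[OF assms(1-4)] by (simp flip: sum_distrib_right)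
  also have "\<dots> = (\<Sum>i\<in>I. dyson_product x y I (a(i := a i - 1)))"
  proof (intro sum.cong refl)
    fix i assume i: "i \<in> I"
    have "(\<Prod>k\<in>I - {i}. ?u k) * (\<Prod>k\<in>I. ?u k ^ (a k - 1))
        = ?u i ^ (a i - 1) * (\<Prod>k\<in>I - {i}. ?u k * ?u k ^ (a k - 1))"
      by (simp add: prod.remove[OF fin i] prod.distrib)
    also have "(\<Prod>k\<in>I - {i}. ?u k * ?u k ^ (a k - 1)) = (\<Prod>k\<in>I - {i}. ?u k ^ a k)"
      using pos by (intro prod.cong refl) (simp flip: power_Suc)
    also have "?u i ^ (a i - 1) * \<dots> = dyson_product x y I (a(i := a i - 1))"
      by (simp add: dyson_product_def prod.remove[OF fin i])
    finally show "(\<Prod>k\<in>I - {i}. ?u k) * (\<Prod>k\<in>I. ?u k ^ (a k - 1))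
        = dyson_product x y I (a(i := a i - 1))" .
  qed
  finally show ?thesis .
qed

text \<open>Row \<open>k\<close> has exponent 0 and disappears; the index \<open>k\<close> then
  survives only through the factor \<open>j = k\<close> of each other row, and these factors are
  collected on the right.\<close>

lemma dyson_product_zero_exponent:
  fixes x y :: "'i \<Rightarrow> 'a::comm_ring_1"
  assumes fin: "finite I" and k: "k \<in> I" and "a k = 0"
  shows "dyson_product x y I a
    = dyson_product x y (I - {k}) a * (\<Prod>i\<in>I - {k}. (1 - x i * y k) ^ a i)"
proof -
  have "dyson_row x y I i = (1 - x i * y k) * dyson_row x y (I - {k}) i" if "i \<in> I - {k}" for i
  proof -
    have "I - {i} - {k} = I - {k} - {i}" by blast
    then show ?thesis
      using prod.remove[of "I - {i}" k "\<lambda>j. 1 - x i * y j"] fin k that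
      by (auto simp: dyson_row_def)
  qed
  then have "(\<Prod>i\<in>I - {k}. dyson_row x y I i ^ a i)
      = (\<Prod>i\<in>I - {k}. dyson_row x y (I - {k}) i ^ a i * (1 - x i * y k) ^ a i)"
    by (intro prod.cong refl) (simp add: power_mult_distrib mult.commute)
  then show ?thesis
    using prod.remove[OF fin k, of "\<lambda>i. dyson_row x y I i ^ a i"] \<open>a k = 0\<close>
    by (simp add: dyson_product_def prod.distrib)
qed

text \<open>Lowering \<open>a i\<close> by one multiplies the multinomial coefficient by
  \<open>a i\<close> over the sum of all \<open>a j\<close>, and these ratios add up to 1.\<close>

lemma multinomial_recursion:
  fixes a :: "'i \<Rightarrow> nat"
  assumes fin: "finite I" and ne: "I \<noteq> {}" and pos: "\<And>i. i \<in> I \<Longrightarrow> a i > 0"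
  shows "(\<Sum>i\<in>I. fact (\<Sum>j\<in>I. (a(i := a i - 1)) j) / (\<Prod>j\<in>I. fact ((a(i := a i - 1)) j)))
    = (fact (\<Sum>j\<in>I. a j) / (\<Prod>j\<in>I. fact (a j)) :: 'a::field_char_0)"
proof -
  let ?s = "\<Sum>j\<in>I. a j"
  have s_pos: "?s > 0"
    using fin ne pos by (simp add: sum_pos)
  have "(\<Sum>i\<in>I. fact (\<Sum>j\<in>I. (a(i := a i - 1)) j) / (\<Prod>j\<in>I. fact ((a(i := a i - 1)) j)))
      = (\<Sum>i\<in>I. of_nat (a i) * (fact (?s - 1) / (\<Prod>j\<in>I. fact (a j))) :: 'a)"
  proof (intro sum.cong refl)
    fix i assume i: "i \<in> I"
    have s: "(\<Sum>j\<in>I. (a(i := a i - 1)) j) = ?s - 1"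
      using pos[OF i] by (simp add: sum.remove[OF fin i])
    have "(\<Prod>j\<in>I. fact (a j)) = of_nat (a i) * (\<Prod>j\<in>I. fact ((a(i := a i - 1)) j) :: 'a)"
      using pos[OF i] by (simp add: prod.remove[OF fin i] fact_reduce)
    then show "fact (\<Sum>j\<in>I. (a(i := a i - 1)) j) / (\<Prod>j\<in>I. fact ((a(i := a i - 1)) j))
        = (of_nat (a i) * (fact (?s - 1) / (\<Prod>j\<in>I. fact (a j))) :: 'a)"
      using pos[OF i] unfolding s by simp
  qed
  also have "\<dots> = of_nat ?s * fact (?s - 1) / (\<Prod>j\<in>I. fact (a j))"
    by (simp add: sum_distrib_right sum_divide_distrib)
  also have "of_nat ?s * fact (?s - 1) = (fact ?s :: 'a)"
    using fact_reduce[OF s_pos, where 'a = 'a] by simp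
  finally show ?thesis .
qed

section \<open>Constant terms\<close>

lemma inj_LX: "inj LX"
proof (rule injI)
  fix i j assume "LX i = LX j"
  then have "Poly_Mapping.keys (LX i) = Poly_Mapping.keys (LX j)" by simp
  then have "Poly_Mapping.single i (1::int) = Poly_Mapping.single j 1"
    by (simp add: LX_def)
  then have "Poly_Mapping.keys (Poly_Mapping.single i (1::int)) = Poly_Mapping.keys (Poly_Mapping.single j (1::int))"
    by simp
  then show "i = j" by simp
qed

lemma constant_term_sum: "constant_term (sum f A) = (\<Sum>i\<in>A. constant_term (f i))"
  by (simp add: constant_term_def lookup_sum)

text \<open>Two choices of \<open>S\<close> matter: \<open>{0}\<close> describes freedom from the
  variable \<open>k\<close>, and \<open>{..<0}\<close> says that every term contains a negative
  power of it.\<close>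

definition degrees_in :: "nat \<Rightarrow> int set \<Rightarrow> laurent_polynomial set" where
  "degrees_in k S = {p. \<forall>m\<in>Poly_Mapping.keys p. Poly_Mapping.lookup m k \<in> S}"

lemma degrees_in_zero: "0 \<in> degrees_in k S"
  by (simp add: degrees_in_def)

lemma degrees_in_one: "0 \<in> S \<Longrightarrow> 1 \<in> degrees_in k S"
  by (simp add: degrees_in_def)

lemma degrees_in_add: "p \<in> degrees_in k S \<Longrightarrow> q \<in> degrees_in k S \<Longrightarrow> p + q \<in> degrees_in k S"
  using keys_add[of p q] by (auto simp: degrees_in_def)

lemma degrees_in_diff: "p \<in> degrees_in k S \<Longrightarrow> q \<in> degrees_in k S \<Longrightarrow> p - q \<in> degrees_in k S"
  by (fastforce simp: degrees_in_def in_keys_iff lookup_minus)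

lemma degrees_in_mult:
  assumes "p \<in> degrees_in k S" "q \<in> degrees_in k T" "\<And>s t. s \<in> S \<Longrightarrow> t \<in> T \<Longrightarrow> s + t \<in> U"
  shows "p * q \<in> degrees_in k U"
  using assms keys_mult[of p q] by (force simp: degrees_in_def lookup_add)

lemma degrees_in_prod:
  assumes "\<And>i. i \<in> A \<Longrightarrow> f i \<in> degrees_in k S" "0 \<in> S" "\<And>s t. s \<in> S \<Longrightarrow> t \<in> S \<Longrightarrow> s + t \<in> S"
  shows "prod f A \<in> degrees_in k S"
  using assms(1)
  by (induction A rule: infinite_finite_induct)
     (auto intro: degrees_in_one degrees_in_mult assms(2,3))

lemma degrees_in_power:
  assumes "p \<in> degrees_in k S" "0 \<in> S" "\<And>s t. s \<in> S \<Longrightarrow> t \<in> S \<Longrightarrow> s + t \<in> S"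
  shows "p ^ e \<in> degrees_in k S"
  using degrees_in_prod[of "{..<e}" "\<lambda>_. p"] assms by simp

lemma LX_mult_LX_inv_degrees_in:
  "i \<noteq> k \<Longrightarrow> j \<noteq> k \<Longrightarrow> LX i * LX_inv j \<in> degrees_in k {0}"
  "i \<noteq> k \<Longrightarrow> LX i * LX_inv k \<in> degrees_in k {..<0}"
  by (simp_all add: degrees_in_def LX_def LX_inv_def mult_single lookup_add lookup_single)

lemma constant_term_degrees_neg: "p \<in> degrees_in k {..<0} \<Longrightarrow> constant_term p = 0"
  by (force simp: degrees_in_def constant_term_def in_keys_iff)

text \<open>Since 0 is not in \<open>{..<0}\<close>, the closure rules for powers and products do
  not apply to this set. Its translate by 1 is closed under multiplication and contains 1, which
  serves instead.\<close>

lemma degrees_neg_mult_minus_one: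
  assumes "p - 1 \<in> degrees_in k {..<0}" "q - 1 \<in> degrees_in k {..<0}"
  shows "p * q - 1 \<in> degrees_in k {..<0}"
proof -
  have "p * q - 1 = (p - 1) * (q - 1) + (p - 1) + (q - 1)"
    by (simp add: algebra_simps)
  moreover have "(p - 1) * (q - 1) \<in> degrees_in k {..<0}"
    using assms by (rule degrees_in_mult) auto
  ultimately show ?thesis
    using assms by (simp only: degrees_in_add)
qed

lemma degrees_neg_power_minus_one:
  "p - 1 \<in> degrees_in k {..<0} \<Longrightarrow> p ^ e - 1 \<in> degrees_in k {..<0}"
  by (induction e) (simp_all add: degrees_neg_mult_minus_one degrees_in_zero)

lemma degrees_neg_prod_minus_one:
  "(\<And>i. i \<in> A \<Longrightarrow> f i - 1 \<in> degrees_in k {..<0}) \<Longrightarrow> prod f A - 1 \<in> degrees_in k {..<0}"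
  by (induction A rule: infinite_finite_induct)
     (simp_all add: degrees_neg_mult_minus_one degrees_in_zero)

lemma constant_term_zero_exponent:
  assumes fin: "finite I" and k: "k \<in> I" and "a k = 0"
  shows "constant_term (dyson_product LX LX_inv I a)
    = constant_term (dyson_product LX LX_inv (I - {k}) a)"
proof -
  let ?d = "dyson_product LX LX_inv (I - {k}) a"
  \<comment> \<open>The factors split off from the rows multiply to \<open>1 + r\<close>, where
    every term of \<open>r\<close> has a negative exponent at \<open>k\<close>. As \<open>?d\<close>
    is free of that variable, no term of \<open>?d * r\<close> is constant.\<close>
  define r where "r = (\<Prod>i\<in>I - {k}. (1 - LX i * LX_inv k) ^ a i) - 1"
  have d: "?d \<in> degrees_in k {0}"
    unfolding dyson_product_def dyson_row_def
    by (intro degrees_in_prod degrees_in_power degrees_in_diff degrees_in_one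
          LX_mult_LX_inv_degrees_in) auto
  have "(1 - LX i * LX_inv k) - 1 \<in> degrees_in k {..<0}" if "i \<noteq> k" for i
    using degrees_in_diff[OF degrees_in_zero LX_mult_LX_inv_degrees_in(2)[OF that]] by simp
  then have "r \<in> degrees_in k {..<0}"
    unfolding r_def by (intro degrees_neg_prod_minus_one degrees_neg_power_minus_one) auto
  with d have "?d * r \<in> degrees_in k {..<0}"
    by (rule degrees_in_mult) auto
  then have "constant_term (?d * r) = 0"
    by (rule constant_term_degrees_neg)
  moreover have "dyson_product LX LX_inv I a = ?d + ?d * r"
    using dyson_product_zero_exponent[of I k a LX LX_inv] assms by (simp add: r_def algebra_simps)
  ultimately show ?thesis
    by (simp add: constant_term_def lookup_add)
qed

theorem constant_term_dyson_product:
  assumes "finite I"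
  shows "constant_term (dyson_product LX LX_inv I a) = fact (\<Sum>i\<in>I. a i) / (\<Prod>i\<in>I. fact (a i))"
  using assms
\<comment> \<open>Removing an index with exponent 0 decreases the cardinality and keeps the sum; the
  recursion decreases the sum and keeps the cardinality.\<close>
proof (induction "card I + sum a I" arbitrary: I a rule: less_induct)
  case less
  note fin = \<open>finite I\<close>
  consider "I = {}" | k where "k \<in> I" "a k = 0" | "I \<noteq> {}" "\<And>i. i \<in> I \<Longrightarrow> a i > 0"
    by blast
  then show ?case
  proof cases
    case 1
    then show ?thesis by (simp add: dyson_product_def constant_term_def)
  next
    case 2
    have "constant_term (dyson_product LX LX_inv (I - {k}) a)
        = fact (\<Sum>i\<in>I - {k}. a i) / (\<Prod>i\<in>I - {k}. fact (a i))"
    proof (rule less.hyps)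
      have "card (I - {k}) < card I"
        using fin 2(1) by (rule card_Diff1_less)
      then show "card (I - {k}) + sum a (I - {k}) < card I + sum a I"
        using fin 2 by (simp add: sum.remove)
    qed (use fin in simp)
    then show ?thesis
      using 2 fin constant_term_zero_exponent[of I k a]
      by (simp add: sum.remove prod.remove)
  next
    case 3
    have "constant_term (dyson_product LX LX_inv I (a(i := a i - 1)))
        = fact (\<Sum>j\<in>I. (a(i := a i - 1)) j) / (\<Prod>j\<in>I. fact ((a(i := a i - 1)) j))"
      if i: "i \<in> I" for i
      using 3(2)[OF i] fin by (intro less.hyps) (auto simp: sum.remove[OF fin i])
    then have "(\<Sum>i\<in>I. constant_term (dyson_product LX LX_inv I (a(i := a i - 1))))
        = fact (\<Sum>i\<in>I. a i) / (\<Prod>i\<in>I. fact (a i))"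
      using multinomial_recursion[OF fin 3, where 'a = rat] by simp
    then show ?thesis
      using dyson_product_recursion[of I LX LX_inv a] 3 fin inj_LX
      by (simp add: constant_term_sum LX_mult_LX_inv inj_on_subset)
  qed
qed

section \<open>Polynomials as Laurent polynomials\<close>

text \<open>The additive extension of a map of exponents to formal sums; coefficients of keys with
  the same image are added. For additive \<open>h\<close> it respects products.\<close>

definition push_keys :: "('a \<Rightarrow> 'b) \<Rightarrow> ('a \<Rightarrow>\<^sub>0 'c) \<Rightarrow> 'b \<Rightarrow>\<^sub>0 'c::comm_monoid_add" where
  "push_keys h p = (\<Sum>m\<in>Poly_Mapping.keys p. Poly_Mapping.single (h m) (Poly_Mapping.lookup p m))"

lemma push_keys_zero [simp]: "push_keys h 0 = 0"
  by (simp add: push_keys_def)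

lemma push_keys_single [simp]: "push_keys h (Poly_Mapping.single m c) = Poly_Mapping.single (h m) c"
  by (simp add: push_keys_def)

lemma push_keys_add: "push_keys h (p + q) = push_keys h p + push_keys h q"
  unfolding push_keys_def by (rule setsum_keys_plus_distrib) (simp_all add: single_add)

lemma push_keys_diff:
  fixes p q :: "'a \<Rightarrow>\<^sub>0 'c::ab_group_add"
  shows "push_keys h (p - q) = push_keys h p - push_keys h q"
  using push_keys_add[of h "p - q" q] by (simp add: algebra_simps)

text \<open>Updating at a fresh key is the same as adding a monomial. Dropping freshness from the
  step gives a form that fits additive maps without case distinctions.\<close>

lemma poly_mapping_add_single_induct [case_names zero add]:
  fixes p :: "'a \<Rightarrow>\<^sub>0 'c::comm_monoid_add"
  assumes "P 0" "\<And>p m c. P p \<Longrightarrow> P (p + Poly_Mapping.single m c)"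
  shows "P p"
proof (induction p rule: update_induct)
  case (update p m c)
  have "Poly_Mapping.update m c p = p + Poly_Mapping.single m c"
    using update(1)
    by (intro poly_mapping_eqI) (auto simp: lookup_update lookup_add lookup_single in_keys_iff when_def)
  then show ?case using assms(2)[OF update(3)] by simp
qed (fact assms(1))

text \<open>Both sides are additive in each factor, so the claim reduces to two monomials, where it
  is the additivity of \<open>h\<close>.\<close>

lemma push_keys_mult:
  fixes p q :: "'a::monoid_add \<Rightarrow>\<^sub>0 'c::semiring_0" and h :: "'a \<Rightarrow> 'b::monoid_add"
  assumes h: "\<And>m n. h (m + n) = h m + h n"
  shows "push_keys h (p * q) = push_keys h p * push_keys h q"
proof (induction p rule: poly_mapping_add_single_induct)
  case (add p m c)
  have "push_keys h (Poly_Mapping.single m c * q) = Poly_Mapping.single (h m) c * push_keys h q"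
    by (induction q rule: poly_mapping_add_single_induct)
       (simp_all add: push_keys_add mult_single h distrib_left)
  with add show ?case by (simp add: push_keys_add distrib_right)
qed simp

lemma lookup_push_keys:
  assumes "inj h"
  shows "Poly_Mapping.lookup (push_keys h p) (h m) = Poly_Mapping.lookup p m"
  by (induction p rule: poly_mapping_add_single_induct)
     (simp_all add: push_keys_add lookup_add lookup_single inj_eq[OF assms])

text \<open>By cancellation, \<open>k\<close> is the only key that the shift by \<open>m\<close>
  sends to \<open>m + k\<close>.\<close>

lemma lookup_single_mult:
  fixes p :: "'a::cancel_comm_monoid_add \<Rightarrow>\<^sub>0 'c::semiring_0"
  shows "Poly_Mapping.lookup (Poly_Mapping.single m c * p) (m + k) = c * Poly_Mapping.lookup p k"
  by (induction p rule: poly_mapping_add_single_induct)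
     (simp_all add: mult_single lookup_add distrib_left lookup_single mult_when)

definition int_exponents :: "(nat \<Rightarrow>\<^sub>0 nat) \<Rightarrow> nat \<Rightarrow>\<^sub>0 int" where
  "int_exponents = Poly_Mapping.map int"

lemma lookup_int_exponents [simp]: "Poly_Mapping.lookup (int_exponents m) k = int (Poly_Mapping.lookup m k)"
  by (simp add: int_exponents_def map.rep_eq when_def)

lemma int_exponents_add: "int_exponents (m + n) = int_exponents m + int_exponents n"
  by (rule poly_mapping_eqI) (simp add: lookup_add)

lemma int_exponents_single: "int_exponents (Poly_Mapping.single i e) = Poly_Mapping.single i (int e)"
  by (rule poly_mapping_eqI) (simp add: lookup_single when_def)

lemma int_exponents_zero: "int_exponents 0 = 0"
  by (rule poly_mapping_eqI) simp

lemma inj_int_exponents: "inj int_exponents"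
proof (rule injI)
  fix m n assume "int_exponents m = int_exponents n"
  then have "Poly_Mapping.lookup (int_exponents m) k = Poly_Mapping.lookup (int_exponents n) k" for k by simp
  then show "m = n" by (intro poly_mapping_eqI) simp
qed

definition to_laurent :: "polynomial \<Rightarrow> laurent_polynomial" where
  "to_laurent = push_keys int_exponents"

lemma to_laurent_one: "to_laurent 1 = 1"
  unfolding to_laurent_def
  by (metis int_exponents_zero push_keys_single single_one)

lemma to_laurent_X: "to_laurent (X i) = LX i"
  by (simp add: to_laurent_def X_def LX_def int_exponents_single)

lemma to_laurent_mult: "to_laurent (p * q) = to_laurent p * to_laurent q"
  by (simp add: to_laurent_def push_keys_mult int_exponents_add)

lemma to_laurent_diff: "to_laurent (p - q) = to_laurent p - to_laurent q"
  by (simp add: to_laurent_def push_keys_diff)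

lemma to_laurent_minus: "to_laurent (- p) = - to_laurent p"
  using to_laurent_diff[of 0 p] by (simp add: to_laurent_def)

lemma to_laurent_power: "to_laurent (p ^ e) = to_laurent p ^ e"
  by (induction e) (simp_all add: to_laurent_one to_laurent_mult)

lemma to_laurent_prod: "to_laurent (prod f A) = (\<Prod>i\<in>A. to_laurent (f i))"
  by (induction A rule: infinite_finite_induct) (simp_all add: to_laurent_one to_laurent_mult)

text \<open>Dividing by a monomial shifts its coefficient to exponent 0.\<close>

lemma constant_term_to_laurent:
  assumes "finite I"
  shows "constant_term ((\<Prod>i\<in>I. LX_inv i ^ e i) * to_laurent p) = coeff_monom p I e"
proof -
  define m where "m = (\<Sum>i\<in>I. Poly_Mapping.single i (e i))"
  have pow: "LX_inv i ^ d = Poly_Mapping.single (- Poly_Mapping.single i (int d)) 1" for i d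
    by (induction d)
       (simp_all add: LX_inv_def mult_single single_add single_uminus algebra_simps
          flip: single_uminus)
  have "(\<Prod>i\<in>I. LX_inv i ^ e i) = Poly_Mapping.single (- int_exponents m) 1"
    unfolding m_def using assms
    by (induction I rule: finite_induct)
       (simp_all add: pow mult_single int_exponents_zero int_exponents_add int_exponents_single)
  \<comment> \<open>Exponent 0 is written as \<open>- int_exponents m + int_exponents m\<close> to
    match the shift rule for coefficients.\<close>
  then have "constant_term ((\<Prod>i\<in>I. LX_inv i ^ e i) * to_laurent p)
      = Poly_Mapping.lookup (Poly_Mapping.single (- int_exponents m) 1 * to_laurent p)
          (- int_exponents m + int_exponents m)"
    by (simp add: constant_term_def)
  also have "\<dots> = Poly_Mapping.lookup p m"
    unfolding lookup_single_mult
    by (simp add: to_laurent_def lookup_push_keys inj_int_exponents)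
  finally show ?thesis by (simp add: coeff_monom_def m_def)
qed

section \<open>Products over ordered pairs\<close>

lemma dyson_product_eq_prod_pairs:
  assumes "finite I"
  shows "dyson_product x y I a
    = (\<Prod>(i, j)\<in>{(i, j). i \<in> I \<and> j \<in> I \<and> i \<noteq> j}. (1 - x i * y j) ^ a i)"
proof -
  have "{(i, j). i \<in> I \<and> j \<in> I \<and> i \<noteq> j} = Sigma I (\<lambda>i. I - {i})" by auto
  then show ?thesis
    using assms
    by (simp add: dyson_product_def dyson_row_def prod_power_distrib prod.Sigma)
qed

text \<open>The pairs with \<open>i > j\<close> are the swaps of those with \<open>i < j\<close>, so
  each factor can be grouped with its mirror image.\<close>

lemma prod_pairs_neq_eq_prod_pairs_less:
  fixes g :: "'i::linorder \<Rightarrow> 'i \<Rightarrow> 'a::comm_monoid_mult"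
  assumes "finite I"
  shows "(\<Prod>(i, j)\<in>{(i, j). i \<in> I \<and> j \<in> I \<and> i \<noteq> j}. g i j)
    = (\<Prod>(i, j)\<in>{(i, j). i \<in> I \<and> j \<in> I \<and> i < j}. g i j * g j i)"
proof -
  let ?L = "{(i, j). i \<in> I \<and> j \<in> I \<and> i < j}"
  have fin: "finite ?L"
    by (rule finite_subset[of _ "I \<times> I"]) (use assms in auto)
  have "{(i, j). i \<in> I \<and> j \<in> I \<and> i \<noteq> j} = ?L \<union> prod.swap ` ?L"
    by (force simp: image_iff)
  then have "(\<Prod>(i, j)\<in>{(i, j). i \<in> I \<and> j \<in> I \<and> i \<noteq> j}. g i j)
      = (\<Prod>(i, j)\<in>?L. g i j) * (\<Prod>(i, j)\<in>prod.swap ` ?L. g i j)"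
    using fin by (simp only:) (intro prod.union_disjoint; auto)
  also have "(\<Prod>(i, j)\<in>prod.swap ` ?L. g i j) = (\<Prod>(i, j)\<in>?L. g j i)"
    by (subst prod.reindex) (auto simp: case_prod_unfold)
  finally show ?thesis
    by (simp add: case_prod_unfold prod.distrib)
qed

lemma dyson_product_eq_prod_differences:
  fixes x y :: "'i::linorder \<Rightarrow> 'a::comm_ring_1"
  assumes fin: "finite I" and inv: "\<And>i. i \<in> I \<Longrightarrow> x i * y i = 1"
  shows "dyson_product x y I a
    = (\<Prod>i\<in>I. y i ^ (sum a I - a i)) *
      (\<Prod>(i, j)\<in>{(i, j). i \<in> I \<and> j \<in> I \<and> i < j}. (-1) ^ a j * (x j - x i) ^ (a i + a j))"
proof -
  let ?L = "{(i, j). i \<in> I \<and> j \<in> I \<and> i < j}"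
  \<comment> \<open>For \<open>i \<in> I\<close> the subtraction is not truncated:
    \<open>sum a I - a i\<close> is the sum of the other exponents, so the monomial also splits over
    ordered pairs.\<close>
  have "(\<Prod>i\<in>I. y i ^ (sum a I - a i)) = (\<Prod>i\<in>I. \<Prod>j\<in>I - {i}. y i ^ a j)"
    using fin by (intro prod.cong refl) (simp add: sum.remove flip: power_sum)
  also have "\<dots> = (\<Prod>(i, j)\<in>Sigma I (\<lambda>i. I - {i}). y i ^ a j)"
    using fin by (simp add: prod.Sigma)
  also have "Sigma I (\<lambda>i. I - {i}) = {(i, j). i \<in> I \<and> j \<in> I \<and> i \<noteq> j}" by auto
  also have "(\<Prod>(i, j)\<in>{(i, j). i \<in> I \<and> j \<in> I \<and> i \<noteq> j}. y i ^ a j)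
      = (\<Prod>(i, j)\<in>?L. y i ^ a j * y j ^ a i)"
    using fin by (rule prod_pairs_neq_eq_prod_pairs_less)
  finally have monomial:
    "(\<Prod>i\<in>I. y i ^ (sum a I - a i)) = (\<Prod>(i, j)\<in>?L. y i ^ a j * y j ^ a i)" .
  have factor: "(1 - x i * y j) ^ a i * (1 - x j * y i) ^ a j
      = y i ^ a j * y j ^ a i * ((-1) ^ a j * (x j - x i) ^ (a i + a j))"
    if "i \<in> I" "j \<in> I" for i j
  proof -
    \<comment> \<open>Both factors are expressed through the same difference
      \<open>x j - x i\<close>; the reversal in the second one is the source of the sign
      \<open>(-1) ^ a j\<close>.\<close>
    have "1 - x i * y j = y j * (x j - x i)" "1 - x j * y i = y i * ((-1) * (x j - x i))"
      using inv[OF that(1)] inv[OF that(2)] by (simp_all add: algebra_simps)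
    then show ?thesis
      by (simp only: power_mult_distrib power_add ac_simps)
  qed
  have "dyson_product x y I a = (\<Prod>(i, j)\<in>?L. (1 - x i * y j) ^ a i * (1 - x j * y i) ^ a j)"
    unfolding dyson_product_eq_prod_pairs[OF fin]
    by (rule prod_pairs_neq_eq_prod_pairs_less[OF fin])
  also have "\<dots> = (\<Prod>(i, j)\<in>?L.
      (y i ^ a j * y j ^ a i) * ((-1) ^ a j * (x j - x i) ^ (a i + a j)))"
    by (intro prod.cong refl) (use factor in auto)
  finally show ?thesis
    unfolding monomial by (simp add: case_prod_unfold prod.distrib)
qed

theorem theorem5p5:
  fixes n :: nat and a :: "nat \<Rightarrow> nat" and \<alpha> :: nat
  assumes pos: "\<And>i. i \<in> {1..n} \<Longrightarrow> a i > 0"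
    and \<alpha>: "\<alpha> = (\<Sum>i=1..n. a i)"
  shows
    "constant_term
       (\<Prod>(i, j)\<in>{(i, j). i \<in> {1..n} \<and> j \<in> {1..n} \<and> i \<noteq> j}. (1 - LX i * LX_inv j) ^ a i)
     = fact \<alpha> / (\<Prod>i=1..n. fact (a i))
     \<and>
     coeff_monom
       (\<Prod>(i, j)\<in>{(i, j). i \<in> {1..n} \<and> j \<in> {1..n} \<and> i < j}.
          (-1) ^ a j * (X j - X i) ^ (a i + a j))
       {1..n} (\<lambda>i. \<alpha> - a i)
     = fact \<alpha> / (\<Prod>i=1..n. fact (a i))"
proof
  let ?f = "\<Prod>(i, j)\<in>{(i, j). i \<in> {1..n} \<and> j \<in> {1..n} \<and> i < j}.
    (-1) ^ a j * (X j - X i) ^ (a i + a j)"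
  have ct: "constant_term (dyson_product LX LX_inv {1..n} a) = fact \<alpha> / (\<Prod>i=1..n. fact (a i))"
    by (simp add: constant_term_dyson_product \<alpha>)
  then show "constant_term
       (\<Prod>(i, j)\<in>{(i, j). i \<in> {1..n} \<and> j \<in> {1..n} \<and> i \<noteq> j}. (1 - LX i * LX_inv j) ^ a i)
     = fact \<alpha> / (\<Prod>i=1..n. fact (a i))"
    by (simp only: dyson_product_eq_prod_pairs[OF finite_atLeastAtMost])
  have "to_laurent ?f = (\<Prod>(i, j)\<in>{(i, j). i \<in> {1..n} \<and> j \<in> {1..n} \<and> i < j}.
      (-1) ^ a j * (LX j - LX i) ^ (a i + a j))"
    by (simp only: to_laurent_prod case_prod_unfold to_laurent_mult to_laurent_power
        to_laurent_diff to_laurent_minus to_laurent_one to_laurent_X)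
  \<comment> \<open>The Dyson product is thus \<open>?f\<close> divided by the monomial with
    exponents \<open>\<alpha> - a i\<close>, so its known constant term is the coefficient
    sought.\<close>
  then have "dyson_product LX LX_inv {1..n} a
      = (\<Prod>i\<in>{1..n}. LX_inv i ^ (\<alpha> - a i)) * to_laurent ?f"
    unfolding \<alpha> by (simp only: dyson_product_eq_prod_differences[OF finite_atLeastAtMost LX_mult_LX_inv])
  then show "coeff_monom ?f {1..n} (\<lambda>i. \<alpha> - a i) = fact \<alpha> / (\<Prod>i=1..n. fact (a i))"
    using ct by (simp only: constant_term_to_laurent[OF finite_atLeastAtMost])
qed

end
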